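(* Let $k\in\mathbb{N}$ and $n_1,\dots,n_k\in\{2,3,4,\dots\}$. An $(n_1,\dots,n_k)$-ary tree $T$ is equivalent to an $(n_1,\dots,n_k)$-ary tree $S$ if and only if $L(T)=L(S)$ and $\mathbf{v}(l_i)=\mathbf{v}(k_i)$ for all $i$, where $l_i$ and $k_i$ denote the leaves with index number $i$ in $T$ and in $S$ respectively.
   Context: An $n$-ary caret (caret of type $n$) is a graph with $n+1$ vertices and $n$ edges: one vertex of degree $n$ (the parent) joined to $n$ vertices of degree 1 (the children), ordered from left to right. An $(n_1,\dots,n_k)$-ary tree is a rooted tree formed by joining a finite number (possibly zero, giving a single vertex) of carets, each of type in $\{n_1,\dots,n_k\}$, by identifying child vertices of carets with parent vertices of other carets. Leaves are the vertices with no children, numbered $0,1,2,\dots$ from left to right; $L(T)$ is the number of leaves of $T$. Each vertex represents a closed subinterval of $[0,1]$: the root vertex represents $[0,1]$, and if the parent vertex of an $n$-ary caret represents $[a,b]$, its children represent, from left to right, the $n$ consecutive closed subintervals of equal length into which $[a,b]$ is subdivided. The leaf intervals give the subdivision of $[0,1]$ represented by the tree. Two trees are equivalent if they represent the same subdivision of $[0,1]$. The leaf path of a leaf is the path from the root vertex to that leaf; a caret is on the leaf path if it has an edge on it. For a leaf $l$, $v_{n_j}(l)$ is the number of $n_j$-ary carets on the leaf path of $l$, and the valence of $l$ is the vector $\mathbf{v}(l)=\langle v_{n_1}(l),\dots,v_{n_k}(l)\rangle$.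
   Formalization: The "only if" direction is proved only for multiplicatively independent n_1,…,n_k (as a set); without this it fails, e.g. for (2,4) a 4-ary caret and the complete binary tree of depth 2 are equivalent with different valences. The "if" direction is unrestricted. *)

theory Defs
  imports Complex_Main
begin

text \<open>The type of a caret is the number of its children, so \<open>Caret ts\<close> is a caret of type
  \<open>length ts\<close> whose \<open>i\<close>-th child from the left is the root of \<open>ts ! i\<close>.\<close>

datatype tree = Leaf | Caret "tree list"

primrec ary_tree :: "nat list \<Rightarrow> tree \<Rightarrow> bool" where
  "ary_tree ns Leaf \<longleftrightarrow> True"
| "ary_tree ns (Caret ts) \<longleftrightarrow> length ts \<in> set ns \<and> list_all (ary_tree ns) ts"

text \<open>A path downwards from the root is the list of its edges; the edge from the parent of an
  \<open>n\<close>-ary caret to its \<open>i\<close>-th child (counted from 0) is recorded as \<open>(n, i)\<close>.\<close>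

type_synonym path = "(nat \<times> nat) list"

text \<open>The leaf paths of all leaves, from left to right: leaf number \<open>i\<close> has leaf path
  \<open>leaf_paths T ! i\<close>.\<close>

primrec leaf_paths :: "tree \<Rightarrow> path list" where
  "leaf_paths Leaf = [[]]"
| "leaf_paths (Caret ts) =
     concat (map (\<lambda>(i, ps). map (\<lambda>p. (length ts, i) # p) ps)
                 (enumerate 0 (map leaf_paths ts)))"

definition num_leaves :: "tree \<Rightarrow> nat" where
  "num_leaves T = length (leaf_paths T)"

text \<open>The interval represented by the vertex that is reached along a path from a vertex
  representing \<open>[a, b]\<close>.\<close>

fun path_interval :: "real \<Rightarrow> real \<Rightarrow> path \<Rightarrow> real set" where
  "path_interval a b [] = {a..b}"
| "path_interval a b ((n, i) # p) =
     path_interval (a + real i * (b - a) / real n) (a + real (i + 1) * (b - a) / real n) p"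

definition subdivision :: "tree \<Rightarrow> real set set" where
  "subdivision T = path_interval 0 1 ` set (leaf_paths T)"

definition equivalent :: "tree \<Rightarrow> tree \<Rightarrow> bool" where
  "equivalent T S \<longleftrightarrow> subdivision T = subdivision S"

definition valence :: "nat list \<Rightarrow> tree \<Rightarrow> nat \<Rightarrow> nat list" where
  "valence ns T i = map (count_list (map fst (leaf_paths T ! i))) ns"

text \<open>Multiplicative independence of the set of types; repetitions in the list are harmless.\<close>

definition mult_independent :: "nat list \<Rightarrow> bool" where
  "mult_independent ns \<longleftrightarrow>
     (\<forall>a b :: nat \<Rightarrow> nat. (\<Prod>n\<in>set ns. n ^ a n) = (\<Prod>n\<in>set ns. n ^ b n)
        \<longrightarrow> (\<forall>n\<in>set ns. a n = b n))"

text \<open>Without multiplicative independence, equivalent trees can have different valences: a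
  4-ary caret and the complete binary tree of depth 2 both represent the subdivision of
  \<open>[0, 1]\<close> into quarters.\<close>

lemma equivalent_different_valence:
  defines "T \<equiv> Caret [Leaf, Leaf, Leaf, Leaf]"
    and "S \<equiv> Caret [Caret [Leaf, Leaf], Caret [Leaf, Leaf]]"
  shows "ary_tree [2, 4] T" "ary_tree [2, 4] S" "equivalent T S"
    "valence [2, 4] T 0 = [0, 1]" "valence [2, 4] S 0 = [2, 0]"
  by (simp_all add: T_def S_def equivalent_def subdivision_def valence_def)

end

theory Submission
  imports Defs
begin

text \<open>The leaf intervals, read from left to right, are consecutive, and a leaf interval has length
  \<open>1 / (n\<^sub>1 ^ v\<^sub>1 \<cdots> n\<^sub>k ^ v\<^sub>k)\<close>, where \<open>v\<close> is the valence of the leaf. So the subdivision and the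
  list of these products determine each other: the first interval is the only one that starts at
  the left end, and one removes it and continues. Multiplicative independence recovers the
  valences from the products.\<close>

primrec consecutive_intervals :: "real \<Rightarrow> real list \<Rightarrow> real set list" where
  "consecutive_intervals a [] = []"
| "consecutive_intervals a (w # ws) = {a..a + w} # consecutive_intervals (a + w) ws"

lemma consecutive_intervals_append:
  "consecutive_intervals a (ws @ vs) =
     consecutive_intervals a ws @ consecutive_intervals (a + sum_list ws) vs"
  by (induction ws arbitrary: a) (simp_all add: add.assoc)

lemma consecutive_intervals_lower_bound:
  assumes "I \<in> set (consecutive_intervals a ws)" "\<forall>w\<in>set ws. 0 < w"
  shows "I \<subseteq> {a..}"
  using assms by (induction ws arbitrary: a) fastforce+

text \<open>A set forgets order and multiplicity. Positive widths restore both: only the first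
  interval contains the left end, so it can be identified and split off.\<close>

lemma consecutive_intervals_set_inject:
  assumes "set (consecutive_intervals a ws) = set (consecutive_intervals a vs)"
    and "\<forall>w\<in>set ws. 0 < w" and "\<forall>v\<in>set vs. 0 < v"
  shows "ws = vs"
  using assms
proof (induction ws arbitrary: a vs)
  case Nil
  then show ?case by (cases vs) auto
next
  case (Cons w ws)
  then obtain v vs' where vs: "vs = v # vs'" by (cases vs) auto
  have pos: "0 < w" "0 < v" "\<forall>w\<in>set ws. 0 < w" "\<forall>v\<in>set vs'. 0 < v"
    using Cons.prems vs by auto
  \<comment> \<open>The point \<open>a\<close> lies in \<open>{a..a + x}\<close> because
    \<open>x\<close> is positive, whereas all later intervals lie in
    \<open>{a + y..}\<close>.\<close>
  have not_later: "{a..a + x} \<notin> set (consecutive_intervals (a + y) us)"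
    if "0 < x" "0 < y" "\<forall>u\<in>set us. 0 < u" for x y us
    using consecutive_intervals_lower_bound[of "{a..a + x}" "a + y" us] that by fastforce
  have "{a..a + w} \<in> set (consecutive_intervals a (v # vs'))"
    unfolding vs[symmetric] Cons.prems(1)[symmetric] by simp
  then have "{a..a + w} = {a..a + v}"
    using not_later[OF pos(1,2,4)] by (simp del: Icc_eq_Icc)
  \<comment> \<open>\<open>Icc_eq_Icc\<close> also allows both intervals to be empty; positive
    widths rule this out.\<close>
  then have "a + w = a + v"
    using pos(1,2) unfolding Icc_eq_Icc by linarith
  then have eq: "w = v" by simp
  \<comment> \<open>The first interval does not recur among the later ones, so deleting it from both
    sets preserves their equality.\<close>
  have "set (consecutive_intervals (a + w) ws) = set (consecutive_intervals (a + w) vs')"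
    using Cons.prems(1) not_later[of w w ws] not_later[of w w vs'] pos vs eq
    by (simp add: insert_ident)
  then show ?case using Cons.IH pos vs eq by blast
qed

definition path_product :: "path \<Rightarrow> nat" where
  "path_product p = prod_list (map fst p)"

lemma path_product_simps [simp]:
  "path_product [] = 1" "path_product (e # p) = fst e * path_product p"
  by (simp_all add: path_product_def)

text \<open>The parameter \<open>d\<close> is the width of the root interval. It varies in the
  induction over trees, since a child's interval is narrower than its parent's.\<close>

definition leaf_widths :: "real \<Rightarrow> path list \<Rightarrow> real list" where
  "leaf_widths d ps = map (\<lambda>p. d / real (path_product p)) ps"

lemma leaf_widths_append: "leaf_widths d (ps @ qs) = leaf_widths d ps @ leaf_widths d qs"
  by (simp add: leaf_widths_def)

lemma leaf_widths_below_edge: "leaf_widths d (map ((#) (n, i)) ps) = leaf_widths (d / real n) ps"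
  by (simp add: leaf_widths_def)

text \<open>The sum of the widths locates the right end of one child's leaf intervals, where those
  of the next child begin. Excluding type 0 excludes \<open>Caret []\<close>, which has no leaves to
  cover the interval.\<close>

lemma path_interval_leaf_paths:
  assumes "ary_tree ns T" "0 \<notin> set ns"
  shows "map (path_interval a b) (leaf_paths T) =
           consecutive_intervals a (leaf_widths (b - a) (leaf_paths T)) \<and>
         sum_list (leaf_widths (b - a) (leaf_paths T)) = b - a"
  using assms
proof (induction T arbitrary: a b)
  case Leaf
  then show ?case by (simp add: leaf_widths_def)
next
  case (Caret ts)
  define n where "n = length ts"
  define d where "d = (b - a) / real n"
  have n: "n \<noteq> 0" using Caret.prems unfolding n_def by (metis ary_tree.simps(2))
  \<comment> \<open>The children are treated one by one: \<open>us\<close> is a run of them whose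
    first member has number \<open>m\<close>, while \<open>n\<close> stays the type of the whole
    caret.\<close>
  let ?paths = "\<lambda>m us. concat (map (\<lambda>(i, ps). map ((#) (n, i)) ps)
                                  (enumerate m (map leaf_paths us)))"
  have segment: "map (path_interval a b) (?paths m us) =
            consecutive_intervals (a + real m * d) (leaf_widths (b - a) (?paths m us)) \<and>
          sum_list (leaf_widths (b - a) (?paths m us)) = real (length us) * d"
    if "set us \<subseteq> set ts" for m us
    using that
  proof (induction us arbitrary: m)
    case Nil
    then show ?case by (simp add: leaf_widths_def)
  next
    case (Cons u us)
    have u: "u \<in> set ts" "ary_tree ns u"
      using Cons.prems Caret.prems(1) by (auto simp: list_all_iff)
    have ends: "a + real i * (b - a) / real n = a + real i * d" for i
      by (simp add: d_def)
    have child: "map (path_interval a b) (map ((#) (n, m)) (leaf_paths u)) =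
        map (path_interval (a + real m * d) (a + real (m + 1) * d)) (leaf_paths u)"
      by (simp only: map_map o_def path_interval.simps ends)
    have "a + real (m + 1) * d - (a + real m * d) = d"
      by (simp add: algebra_simps)
    then have first:
      "map (path_interval a b) (map ((#) (n, m)) (leaf_paths u)) =
         consecutive_intervals (a + real m * d) (leaf_widths d (leaf_paths u))"
      "sum_list (leaf_widths d (leaf_paths u)) = d"
      using Caret.IH[OF u Caret.prems(2), of "a + real m * d" "a + real (m + 1) * d"]
      unfolding child by (simp_all only:)
    have step: "a + real m * d + d = a + real (Suc m) * d"
      by (simp add: algebra_simps)
    have paths: "?paths m (u # us) = map ((#) (n, m)) (leaf_paths u) @ ?paths (Suc m) us"
      by simp
    have rest: "map (path_interval a b) (?paths (Suc m) us) =
            consecutive_intervals (a + real (Suc m) * d) (leaf_widths (b - a) (?paths (Suc m) us))"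
          "sum_list (leaf_widths (b - a) (?paths (Suc m) us)) = real (length us) * d"
      using Cons.IH[of "Suc m"] Cons.prems by auto
    show ?case
      unfolding paths map_append[of "path_interval a b"] leaf_widths_append
        leaf_widths_below_edge consecutive_intervals_append sum_list_append
        first rest d_def[symmetric] step
      by (simp add: algebra_simps)
  qed
  have "leaf_paths (Caret ts) = ?paths 0 ts"
    by (simp add: n_def)
  moreover have "real (length ts) * d = b - a"
    using n by (simp add: d_def n_def)
  ultimately show ?case
    using segment[of ts 0] by simp
qed

lemma subdivision_eq_consecutive_intervals:
  assumes "ary_tree ns T" "0 \<notin> set ns"
  shows "subdivision T = set (consecutive_intervals 0 (leaf_widths 1 (leaf_paths T)))"
  using path_interval_leaf_paths[OF assms, of 0 1]
  by (metis diff_zero list.set_map subdivision_def)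

lemma leaf_path_types:
  "ary_tree ns T \<Longrightarrow> p \<in> set (leaf_paths T) \<Longrightarrow> set (map fst p) \<subseteq> set ns"
proof (induction T arbitrary: p)
  case Leaf
  then show ?case by simp
next
  case (Caret ts)
  then obtain i q where p: "p = (length ts, i) # q" and i: "i < length ts"
    and q: "q \<in> set (leaf_paths (ts ! i))"
    by (auto simp: in_set_enumerate_eq)
  then have "set (map fst q) \<subseteq> set ns"
    using Caret.IH[of "ts ! i" q] Caret.prems(1) by (auto simp: list_all_length)
  then show ?case using p Caret.prems(1) by simp
qed

text \<open>Equal factors are collected into powers. Elements of \<open>A\<close> outside the list
  get exponent 0, so the products of all leaf paths can range over the same set of types.\<close>

lemma prod_list_eq_prod_count_list:
  fixes xs :: "'a::comm_monoid_mult list"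
  assumes "finite A" "set xs \<subseteq> A"
  shows "prod_list xs = (\<Prod>x\<in>A. x ^ count_list xs x)"
  using assms(2)
proof (induction xs)
  case Nil
  then show ?case by simp
next
  case (Cons y xs)
  have "(\<Prod>x\<in>A. x ^ count_list (y # xs) x) =
      (\<Prod>x\<in>A. (if x = y then x else 1) * x ^ count_list xs x)"
    by (intro prod.cong) auto
  also have "\<dots> = y * (\<Prod>x\<in>A. x ^ count_list xs x)"
    using Cons.prems assms(1) by (simp add: prod.distrib)
  finally show ?case using Cons by simp
qed

lemma path_product_leaf_path:
  assumes "ary_tree ns T" "p \<in> set (leaf_paths T)"
  shows "path_product p = (\<Prod>n\<in>set ns. n ^ count_list (map fst p) n)"
  unfolding path_product_def
  using prod_list_eq_prod_count_list leaf_path_types[OF assms] by blast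

lemma path_product_leaf_path_pos:
  assumes "ary_tree ns T" "0 \<notin> set ns" "p \<in> set (leaf_paths T)"
  shows "0 < path_product p"
  using assms by (auto simp: path_product_leaf_path intro!: prod_pos gr0I)

lemma equivalent_iff_path_products:
  assumes "0 \<notin> set ns" "ary_tree ns T" "ary_tree ns S"
  shows "equivalent T S \<longleftrightarrow>
    map path_product (leaf_paths T) = map path_product (leaf_paths S)"
proof -
  have "equivalent T S \<longleftrightarrow> leaf_widths 1 (leaf_paths T) = leaf_widths 1 (leaf_paths S)"
  proof
    have pos: "\<forall>w\<in>set (leaf_widths 1 (leaf_paths U)). 0 < w" if "ary_tree ns U" for U
      using path_product_leaf_path_pos[OF that assms(1)] by (auto simp: leaf_widths_def)
    show "leaf_widths 1 (leaf_paths T) = leaf_widths 1 (leaf_paths S)" if "equivalent T S"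
      using that assms pos consecutive_intervals_set_inject
      unfolding equivalent_def by (metis subdivision_eq_consecutive_intervals)
  qed (metis assms equivalent_def subdivision_eq_consecutive_intervals)
  also have "\<dots> \<longleftrightarrow> map path_product (leaf_paths T) = map path_product (leaf_paths S)"
  proof -
    \<comment> \<open>Injectivity extends to \<open>k = 0\<close>, because \<open>1 / 0 = 0\<close>
      differs from every other value.\<close>
    have "inj (\<lambda>k::nat. 1 / real k)" by (auto intro!: injI)
    moreover have "leaf_widths 1 ps = map (\<lambda>k. 1 / real k) (map path_product ps)" for ps
      by (simp add: leaf_widths_def)
    ultimately show ?thesis by (simp only: inj_map_eq_map)
  qed
  finally show ?thesis .
qed

text \<open>Both directions compare path products leaf by leaf. A valence determines its product;
  the way back needs independence, as \<open>equivalent_different_valence\<close> shows.\<close>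

theorem theorem2p2:
  fixes ns :: "nat list" and T S :: tree
  assumes "ns \<noteq> []" and "\<forall>n\<in>set ns. n \<ge> 2"
    and "ary_tree ns T" and "ary_tree ns S"
  shows "(num_leaves T = num_leaves S \<and> (\<forall>i<num_leaves T. valence ns T i = valence ns S i)
            \<longrightarrow> equivalent T S) \<and>
         (mult_independent ns \<longrightarrow> equivalent T S \<longrightarrow>
            num_leaves T = num_leaves S \<and> (\<forall>i<num_leaves T. valence ns T i = valence ns S i))"
proof -
  let ?count = "\<lambda>U i. count_list (map fst (leaf_paths U ! i))"
  have "0 \<notin> set ns" using assms(2) by auto
  note equiv = equivalent_iff_path_products[OF this assms(3,4)]
  have product: "path_product (leaf_paths U ! i) = (\<Prod>n\<in>set ns. n ^ ?count U i n)"
    if "ary_tree ns U" "i < num_leaves U" for U i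
    using that by (simp add: num_leaves_def path_product_leaf_path)
  \<comment> \<open>This passes from entries indexed by positions in \<open>ns\<close>, possibly
    with repeated types, to the set \<open>set ns\<close> over which the products run.\<close>
  have valence: "valence ns T i = valence ns S i \<longleftrightarrow> (\<forall>n\<in>set ns. ?count T i n = ?count S i n)"
    for i by (simp add: valence_def)
  show ?thesis
  proof (intro conjI impI; (elim conjE)?)
    assume len: "num_leaves T = num_leaves S"
      and val: "\<forall>i<num_leaves T. valence ns T i = valence ns S i"
    have "path_product (leaf_paths T ! i) = path_product (leaf_paths S ! i)"
      if "i < num_leaves T" for i
      using that len val assms(3,4) by (simp add: product valence cong: prod.cong)
    then show "equivalent T S"
      unfolding equiv using len by (intro nth_equalityI) (simp_all add: num_leaves_def)
  next
    assume indep: "mult_independent ns" and "equivalent T S"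
    then have eq: "map path_product (leaf_paths T) = map path_product (leaf_paths S)"
      using equiv by simp
    then show len: "num_leaves T = num_leaves S"
      unfolding num_leaves_def by (rule map_eq_imp_length_eq)
    show "\<forall>i<num_leaves T. valence ns T i = valence ns S i"
    proof (intro allI impI)
      fix i assume i: "i < num_leaves T"
      have "path_product (leaf_paths T ! i) = path_product (leaf_paths S ! i)"
        using eq i len by (metis nth_map num_leaves_def)
      then have "(\<Prod>n\<in>set ns. n ^ ?count T i n) = (\<Prod>n\<in>set ns. n ^ ?count S i n)"
        using i len assms(3,4) by (simp add: product)
      \<comment> \<open>The caret counts of the two leaves serve as the exponent functions
        \<open>a\<close> and \<open>b\<close> of \<open>mult_independent\<close>.\<close>
      then show "valence ns T i = valence ns S i"
        using indep unfolding valence mult_independent_def by blast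
    qed
  qed
qed

end
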